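(* Let $L, P \in 2\mathbb{N}$ be given. If both functions $f, \hat f \in C(\mathbb{R})$ have polynomial decay $$\sup_{x\in\mathbb{R}} |f(x)|\,(1+|x|)^a \le c < \infty,\quad a>1,\qquad \sup_{v\in\mathbb{R}} |\hat f(v)|\,(1+|v|)^b \le d<\infty,\quad b>1,$$ then $$M_{P,L}^{\ast}(f) \le M_{P,L}(f) \le 2d\,(2^b-1)\,\zeta(b)\,L^{-1/2}P^{-b} + 2c\,(2^a-1)\,\zeta(a)\,L^{-a+1/2}.$$
   Context: $2\mathbb{N}$ denotes the set of positive even integers; $C(\mathbb{R})$ is the set of continuous functions $\mathbb{R}\to\mathbb{C}$; $\zeta$ is the Riemann zeta function. The Fourier transform is $\hat f(v) = \int_{\mathbb{R}} f(x)\,\mathrm{e}^{-2\pi \mathrm{i} xv}\,\mathrm{d}x$, $v\in\mathbb{R}$. For $L,P\in 2\mathbb{N}$ let $[LP] := \{ j\in\mathbb{Z} : -\tfrac{LP}{2} < j \le \tfrac{LP}{2}\}$ and define $$s_{P,L}(v) := \frac1P \sum_{n\in[LP]} f\!\left(\frac nP\right)\mathrm{e}^{-2\pi\mathrm{i} nv/P},\quad v\in\mathbb{R},$$ $$M_{P,L}(f) := \frac{1}{\sqrt L}\max_{|v|\le P/2}|\hat f(v)-s_{P,L}(v)|,\qquad M^{\ast}_{P,L}(f) := \frac{1}{\sqrt L}\max_{k\in[LP]}\left|\hat f\!\left(\tfrac kL\right)-s_{P,L}\!\left(\tfrac kL\right)\right|.$$ *)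

theory Defs
  imports "HOL-Analysis.Analysis"
begin

definition fourier :: "(real \<Rightarrow> complex) \<Rightarrow> real \<Rightarrow> complex" where
  "fourier f v = (LINT x|lborel. f x * exp (- (2 * of_real pi * \<i> * of_real x * of_real v)))"

(* The Dirichlet series of the Riemann zeta function; it represents zeta only for s > 1,
   and is a meaningless value of suminf otherwise. *)
definition zeta :: "real \<Rightarrow> real" where
  "zeta s = (\<Sum>n. 1 / real (Suc n) powr s)"

(* The index set [N] of integers j with -N/2 < j \<le> N/2. *)
definition centered :: "nat \<Rightarrow> int set" where
  "centered N = {j. - (real N / 2) < real_of_int j \<and> real_of_int j \<le> real N / 2}"

definition s_sum :: "nat \<Rightarrow> nat \<Rightarrow> (real \<Rightarrow> complex) \<Rightarrow> real \<Rightarrow> complex" where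
  "s_sum P L f v = 1 / of_nat P *
     (\<Sum>n\<in>centered (L * P). f (real_of_int n / real P) *
        exp (- (2 * of_real pi * \<i> * of_int n * of_real v / of_nat P)))"

(* The maximum over the compact interval is rendered as a supremum;
   see M_attained below. *)
definition M :: "nat \<Rightarrow> nat \<Rightarrow> (real \<Rightarrow> complex) \<Rightarrow> real" where
  "M P L f = 1 / sqrt (real L) *
     (SUP v\<in>{v. \<bar>v\<bar> \<le> real P / 2}. cmod (fourier f v - s_sum P L f v))"

definition Mstar :: "nat \<Rightarrow> nat \<Rightarrow> (real \<Rightarrow> complex) \<Rightarrow> real" where
  "Mstar P L f = 1 / sqrt (real L) *
     (MAX k\<in>centered (L * P).
        cmod (fourier f (real_of_int k / real L) - s_sum P L f (real_of_int k / real L)))"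

lemma M_attained:
  assumes "continuous_on UNIV (fourier f)"
  shows "\<exists>v. \<bar>v\<bar> \<le> real P / 2 \<and>
           M P L f = 1 / sqrt (real L) * cmod (fourier f v - s_sum P L f v) \<and>
           (\<forall>w. \<bar>w\<bar> \<le> real P / 2 \<longrightarrow>
              cmod (fourier f w - s_sum P L f w) \<le> cmod (fourier f v - s_sum P L f v))"
proof -
  let ?g = "\<lambda>v. cmod (fourier f v - s_sum P L f v)"
  let ?I = "{v. \<bar>v\<bar> \<le> real P / 2}"
  have I: "?I = {- (real P / 2)..real P / 2}" by auto
  have "continuous_on ?I (fourier f)"
    using assms continuous_on_subset by blast
  moreover have "continuous_on ?I (s_sum P L f)"
    unfolding s_sum_def divide_inverse by (intro continuous_intros)
  ultimately have "continuous_on ?I ?g"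
    by (intro continuous_intros)
  moreover have "compact ?I" "?I \<noteq> {}"
    unfolding I by auto
  ultimately obtain v where v: "v \<in> ?I" "\<forall>w\<in>?I. ?g w \<le> ?g v"
    using continuous_attains_sup[of ?I ?g] by blast
  then have "(SUP w\<in>?I. ?g w) = ?g v"
    by (intro cSup_eq_maximum) auto
  then show ?thesis
    using v by (auto simp: M_def)
qed

end

theory Submission
  imports Defs
begin

text \<open>
  Poisson summation for the modulated function $x \mapsto f(x/P)\, e^{-2\pi i x v/P}$ gives
  $\frac1P \sum_{n\in\mathbb{Z}} f(n/P)\, e^{-2\pi i n v/P} = \sum_{k\in\mathbb{Z}} \hat f(v + kP)$.
  Hence $\hat f(v) - s_{P,L}(v)$ is the tail of the left side over $n \notin [LP]$ minus the terms
  $k \neq 0$ of the right side. For $|v| \le P/2$ we have $|v + kP| \ge (|k| - \frac12) P$, and writing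
  $n = j + kLP$ with $j \in [LP]$ and $k \neq 0$ we have $|n|/P \ge (|k| - \frac12) L$, so both parts are
  controlled by $\sum_{k\neq 0} (|k| - \frac12)^{-s} = 2 (2^s - 1) \zeta(s)$.

  Periodizing on the side of $f$ avoids Fourier inversion: the periodization and the series of the
  $\hat f$-values have the same Fourier coefficients by direct computation, and continuous periodic
  functions with equal coefficients agree by the Stone-Weierstrass theorem on the circle.
\<close>

subsection \<open>Uniqueness of Fourier coefficients\<close>

text \<open>The exponent carries a plus sign, so this is the coefficient of index \<open>-k\<close> in the usual convention.\<close>

definition fcoeff :: "(real \<Rightarrow> complex) \<Rightarrow> int \<Rightarrow> complex" where
  "fcoeff D k = integral {0..1} (\<lambda>t. D t * cis (2 * pi * of_int k * t))"

lemma continuous_on_cis_linear [continuous_intros]: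
  "continuous_on S (\<lambda>t. cis (c * t))"
  unfolding cis_conv_exp by (intro continuous_intros)

lemma continuous_on_polynomial_cis:
  assumes "real_polynomial_function p"
  shows "continuous_on S (\<lambda>t. p (cis (c * t)))"
proof -
  have "continuous_on UNIV p"
    using assms continuous_polymonial_function[of p]
    by (simp add: continuous_on_eq_continuous_at real_polynomial_function_eq)
  then show ?thesis
    by (intro continuous_on_compose2[OF _ continuous_on_cis_linear]) auto
qed

text \<open>Multiplying by cos or sin moves the coefficient index by plus or minus one, so functions
  with all coefficients zero are stable under multiplication by the two coordinates on the circle,
  and hence by any polynomial in them. \<open>D\<close> stays arbitrary in the induction because the
  product case changes it.\<close>

lemma fcoeff_real_polynomial_mult:
  assumes "real_polynomial_function p" "continuous_on {0..1} D" "\<And>k. fcoeff D k = 0"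
  shows "fcoeff (\<lambda>t. complex_of_real (p (cis (2 * pi * t))) * D t) k = 0"
  using assms
proof (induction p arbitrary: D k rule: real_polynomial_function.induct)
  case (linear h)
  \<comment> \<open>A real-linear \<open>h\<close> on the plane is determined by its values at the
    basis vectors 1 and i.\<close>
  define \<alpha> \<beta> :: complex where "\<alpha> = of_real (h 1)" and "\<beta> = of_real (h \<i>)"
  note prems = linear.prems
  interpret bounded_linear h by fact
  have h: "complex_of_real (h (cis s)) = \<alpha> * of_real (cos s) + \<beta> * of_real (sin s)" for s
  proof -
    have "cis s = cos s *\<^sub>R 1 + sin s *\<^sub>R \<i>"
      by (simp add: complex_eq_iff)
    then have "h (cis s) = cos s * h 1 + sin s * h \<i>"
      by (simp add: add scaleR)
    then show ?thesis by (simp add: \<alpha>_def \<beta>_def)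
  qed
  have I: "(\<lambda>t. D t * cis (2 * pi * of_int j * t)) integrable_on {0..1}" for j
    by (intro integrable_continuous_real continuous_intros prems)
  \<comment> \<open>Euler's formulas: cos is (e + 1/e)/2 and sin is (e - 1/e)/(2i) with e =
    \<open>cis (2 * pi * t)\<close>, and each of e and 1/e is absorbed into the character of index
    \<open>k\<close>.\<close>
  have "complex_of_real (h (cis (2 * pi * t))) * D t * cis (2 * pi * of_int k * t)
      = (\<alpha>/2 + \<beta>/(2*\<i>)) * (D t * cis (2 * pi * of_int (k+1) * t))
      + (\<alpha>/2 - \<beta>/(2*\<i>)) * (D t * cis (2 * pi * of_int (k-1) * t))" for t
  proof -
    have 1: "cis (2 * pi * of_int (k+1) * t) = cis (2 * pi * of_int k * t) * cis (2 * pi * t)"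
      by (simp add: cis_mult algebra_simps)
    have 2: "cis (2 * pi * of_int (k-1) * t) = cis (2 * pi * of_int k * t) * cis (- (2 * pi * t))"
      by (simp add: cis_mult algebra_simps)
    have 3: "cis (2 * pi * t) = of_real (cos (2*pi*t)) + \<i> * of_real (sin (2*pi*t))"
       "cis (-(2 * pi * t)) = of_real (cos (2*pi*t)) - \<i> * of_real (sin (2*pi*t))"
      by (simp_all add: complex_eq_iff)
    show ?thesis unfolding h unfolding 1 2 3 by (simp add: field_simps)
  qed
  then have "fcoeff (\<lambda>t. complex_of_real (h (cis (2 * pi * t))) * D t) k
      = (\<alpha>/2 + \<beta>/(2*\<i>)) * fcoeff D (k+1) + (\<alpha>/2 - \<beta>/(2*\<i>)) * fcoeff D (k-1)"
    unfolding fcoeff_def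
    by (simp only:) (subst integral_add; (intro integrable_on_mult_right I)?; simp only: integral_mult_right)
  then show ?case using prems by simp
next
  case (const c)
  have "fcoeff (\<lambda>t. complex_of_real c * D t) k = of_real c * fcoeff D k"
    by (simp add: fcoeff_def mult.assoc)
  then show ?case using const by simp
next
  case (add p q)
  have I: "(\<lambda>t. complex_of_real (r (cis (2 * pi * t))) * D t * cis (2 * pi * of_int k * t)) integrable_on {0..1}"
    if "real_polynomial_function r" for r
    by (intro integrable_continuous_real continuous_intros add continuous_on_polynomial_cis that)
  have "fcoeff (\<lambda>t. complex_of_real (p (cis (2 * pi * t)) + q (cis (2 * pi * t))) * D t) k
      = fcoeff (\<lambda>t. complex_of_real (p (cis (2 * pi * t))) * D t) k
        + fcoeff (\<lambda>t. complex_of_real (q (cis (2 * pi * t))) * D t) k"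
    unfolding fcoeff_def using I[OF add(1)] I[OF add(2)]
    by (subst integral_add[symmetric]) (auto simp: algebra_simps)
  then show ?case using add by simp
next
  case (mult p q)
  \<comment> \<open>The hypothesis for \<open>p\<close> is applied to the function q times D, whose
    coefficients vanish by the hypothesis for \<open>q\<close>.\<close>
  have "fcoeff (\<lambda>t. complex_of_real (p (cis (2 * pi * t))) * (complex_of_real (q (cis (2 * pi * t))) * D t)) k = 0"
    by (intro mult continuous_intros continuous_on_polynomial_cis)
  then show ?case by (simp add: mult.assoc)
qed

text \<open>Since \<open>r 0 = r 1\<close>, \<open>r\<close> is a continuous function on the circle,
  hence a uniform limit of polynomials in the coordinates. For these the integral against
  \<open>D\<close> is a coefficient of index 0 and vanishes.\<close>

lemma integral_mult_fcoeff_zero: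
  fixes r :: "real \<Rightarrow> real"
  assumes D: "continuous_on {0..1} D" "\<And>k. fcoeff D k = 0"
    and r: "continuous_on {0..1} r" "r 0 = r 1"
  shows "integral {0..1} (\<lambda>t. complex_of_real (r t) * D t) = 0"
proof -
  define q where "q = r \<circ> (\<lambda>z. Arg2pi z / (2 * pi))"
  \<comment> \<open>The trivial homotopy of the loop \<open>r\<close>, carried over to circle maps,
    yields continuity of \<open>q\<close> also at the point 1, where \<open>Arg2pi\<close>
    jumps.\<close>
  have "homotopic_loops UNIV r r"
    using r by (simp add: homotopic_loops_refl path_def pathstart_def pathfinish_def)
  then have q: "continuous_on (sphere 0 1) q"
    unfolding q_def
    using homotopic_loops_imp_homotopic_circlemaps homotopic_with_imp_continuous by blast
  have qr: "q (cis (2 * pi * t)) = r t" if t: "t \<in> {0..1}" for t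
  \<comment> \<open>The endpoint is separate: there \<open>Arg2pi\<close> returns 0, so
    \<open>q\<close> gives \<open>r 0\<close>, which equals \<open>r 1\<close>.\<close>
  proof (cases "t = 1")
    case True
    have "Arg2pi 1 = 0"
      using Arg2pi_of_real[of 1] by simp
    then show ?thesis
      using r True by (simp add: q_def)
  next
    case False
    then have "0 \<le> 2 * pi * t" "2 * pi * t < 2 * pi" using t by auto
    then have "Arg2pi (cis (2 * pi * t)) = 2 * pi * t"
      by (intro Arg2pi_unique[of 1]) (auto simp: cis_conv_exp)
    then show ?thesis by (simp add: q_def)
  qed
  obtain B where B: "\<And>t. t \<in> {0..1} \<Longrightarrow> cmod (D t) \<le> B"
  proof -
    have "bounded (D ` {0..1})"
      using D(1) compact_continuous_image compact_imp_bounded by blast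
    then show thesis
      using that unfolding bounded_iff by (metis imageI)
  qed
  have "0 \<le> B" using B[of 0] norm_ge_zero[of "D 0"] by (simp del: norm_ge_zero)
  have "cmod (integral {0..1} (\<lambda>t. complex_of_real (r t) * D t)) \<le> e" if "e > 0" for e
  proof -
    \<comment> \<open>The summand 1 keeps the denominator positive when \<open>B\<close> is
      0.\<close>
    define \<epsilon> where "\<epsilon> = e / (B + 1)"
    have \<epsilon>: "\<epsilon> > 0" "\<epsilon> * B \<le> e" using \<open>0 \<le> B\<close> that by (auto simp: \<epsilon>_def field_simps)
    obtain p where p: "real_polynomial_function p" "\<And>z. z \<in> sphere 0 1 \<Longrightarrow> \<bar>q z - p z\<bar> < \<epsilon>"
      using Stone_Weierstrass_real_polynomial_function[OF compact_sphere q \<epsilon>(1)] by blast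
    have c: "continuous_on {0..1} (\<lambda>t. complex_of_real (p (cis (2 * pi * t))) * D t)"
       "continuous_on {0..1} (\<lambda>t. complex_of_real (r t) * D t)"
      by (intro continuous_intros continuous_on_polynomial_cis p D r)+
    have "integral {0..1} (\<lambda>t. complex_of_real (p (cis (2 * pi * t))) * D t) = 0"
      using fcoeff_real_polynomial_mult[OF p(1) D, of 0] by (simp add: fcoeff_def)
    then have "integral {0..1} (\<lambda>t. complex_of_real (r t) * D t)
       = integral {0..1} (\<lambda>t. complex_of_real (r t) * D t - complex_of_real (p (cis (2 * pi * t))) * D t)"
      using c by (subst integral_diff) (auto intro!: integrable_continuous_real)
    also have "cmod \<dots> \<le> \<epsilon> * B * (1 - 0)"
    proof (rule integral_bound)
      fix t :: real assume t: "t \<in> {0..1}"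
      have "\<bar>r t - p (cis (2 * pi * t))\<bar> \<le> \<epsilon>"
        using p(2)[of "cis (2 * pi * t)"] qr[OF t] by simp
      moreover have "cmod (complex_of_real (r t) * D t - complex_of_real (p (cis (2 * pi * t))) * D t)
          = \<bar>r t - p (cis (2 * pi * t))\<bar> * cmod (D t)"
        by (metis left_diff_distrib norm_mult norm_of_real of_real_diff)
      ultimately show "cmod (complex_of_real (r t) * D t - complex_of_real (p (cis (2 * pi * t))) * D t) \<le> \<epsilon> * B"
        using B[OF t] \<epsilon> by (simp add: mult_mono)
    qed (use c in \<open>auto intro!: continuous_intros\<close>)
    finally show ?thesis using \<epsilon> by simp
  qed
  then show ?thesis
    by (metis dense_ge norm_le_zero_iff)
qed

text \<open>With r = Re D the real part of the vanishing integral of r times D is the integral of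
  the square of Re D, so the continuous function Re D is zero; Im D is treated alike through the
  imaginary part.\<close>

lemma fcoeff_unique:
  assumes D: "continuous_on {0..1} D" "\<And>k. fcoeff D k = 0" "D 0 = D 1" and t: "t \<in> {0..1}"
  shows "D t = 0"
proof -
  have int: "(\<lambda>t. complex_of_real (r t) * D t) integrable_on {0..1}" if "continuous_on {0..1} r" for r
    by (intro integrable_continuous_real continuous_intros D that)
  have sq: "s t = 0" if s: "continuous_on {0..1} s" "integral {0..1} (\<lambda>t. s t * s t) = 0" for s :: "real \<Rightarrow> real"
  proof -
    have "integral {0..1} (\<lambda>t. s t * s t) = 0 \<longleftrightarrow> (\<forall>t\<in>{0..1}. s t * s t = 0)"
      by (rule integral_eq_0_iff) (auto intro!: continuous_intros s)
    then show ?thesis using s t by auto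
  qed
  have c: "continuous_on {0..1} (\<lambda>t. Re (D t))" "continuous_on {0..1} (\<lambda>t. Im (D t))"
    by (intro continuous_intros D)+
  have "Re (D t) = 0"
    using integral_mult_fcoeff_zero[OF D(1,2) c(1)] D(3) int[OF c(1)] sq[OF c(1)]
    by (auto dest!: integral_linear[OF _ bounded_linear_Re] simp: o_def)
  moreover have "Im (D t) = 0"
    using integral_mult_fcoeff_zero[OF D(1,2) c(2)] D(3) int[OF c(2)] sq[OF c(2)]
    by (auto dest!: integral_linear[OF _ bounded_linear_Im] simp: o_def)
  ultimately show ?thesis by (simp add: complex_eq_iff)
qed

lemma eventually_real_ge: "\<forall>\<^sub>F N in sequentially. y \<le> real N"
  using eventually_ge_at_top[of "nat \<lceil>y\<rceil>"] by eventually_elim linarith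

subsection \<open>Poisson summation\<close>

text \<open>The half-open index range lists the left endpoints of the unit intervals filling
  [-N, N]; each induction step adds one interval at either end.\<close>

lemma integral_eq_sum_unit_intervals:
  fixes h :: "real \<Rightarrow> 'b::banach"
  assumes "continuous_on UNIV h"
  shows "integral {- real N..real N} h
       = (\<Sum>n\<in>{- int N..<int N}. integral {0..1} (\<lambda>x. h (x + of_int n)))"
proof (induction N)
  case 0
  then show ?case by simp
next
  case (Suc N)
  have i: "h integrable_on {a..b}" for a b
    by (meson assms continuous_on_subset integrable_continuous_real top_greatest)
  have s: "integral {0..1} (\<lambda>x. h (x + c)) = integral {c..c+1} h" for c
    using integral_shift_real_ivl[of c c "c+1" h] by simp
  have "{- int (Suc N)..<int (Suc N)} = insert (- int N - 1) (insert (int N) {- int N..<int N})"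
    by auto
  then have "(\<Sum>n\<in>{- int (Suc N)..<int (Suc N)}. integral {0..1} (\<lambda>x. h (x + of_int n)))
     = integral {- real N - 1..- real N} h + (integral {real N..real N + 1} h + integral {- real N..real N} h)"
    by (simp add: s Suc.IH[unfolded s])
  also have "\<dots> = integral {- real N - 1..- real N} h + integral {- real N..real N + 1} h"
    using Henstock_Kurzweil_Integration.integral_combine[where a = "- real N" and c = "real N" and b = "real N + 1" and f = h] i by (simp add: add.commute)
  also have "\<dots> = integral {- real N - 1..real N + 1} h"
    using Henstock_Kurzweil_Integration.integral_combine[where a = "- real N - 1" and c = "- real N" and b = "real N + 1" and f = h] i by simp
  moreover have "- real (Suc N) = - real N - 1" "real (Suc N) = real N + 1"
    by simp_all
  ultimately show ?case by (simp only:)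
qed

text \<open>Each unit interval contributes at most \<open>u n\<close> to the integral of |g|, so the
  integrals over [-N, N] are increasing and bounded by the sum of \<open>u\<close>; monotone
  convergence concludes.\<close>

lemma integrable_periodic_bound:
  fixes g :: "real \<Rightarrow> complex"
  assumes g: "continuous_on UNIV g"
    and u: "u summable_on (UNIV :: int set)"
    and bnd: "\<And>x n. x \<in> {0..1} \<Longrightarrow> cmod (g (x + of_int n)) \<le> u n"
  shows "integrable lborel g"
proof -
  have u0: "0 \<le> u n" for n
    using order_trans[OF norm_ge_zero bnd[of 0 n]] by simp
  have m [measurable]: "g \<in> borel_measurable borel"
    using g by (rule borel_measurable_continuous_onI)
  have cn: "continuous_on S (\<lambda>x. cmod (g x))" for S
    by (intro continuous_on_norm continuous_on_subset[OF g]) auto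
  let ?h = "\<lambda>N x. indicator {- real N..real N} x * cmod (g x)"
  have int: "integrable lborel (?h N)" for N
    using borel_integrable_compact[OF compact_Icc cn, of "- real N" "real N"] by simp
  have eq: "integral\<^sup>L lborel (?h N) = integral {- real N..real N} (\<lambda>x. cmod (g x))" for N
    using set_borel_integral_eq_integral(2)[of "{- real N..real N}" "\<lambda>x. cmod (g x)"] int[of N]
    by (simp add: set_integrable_def set_lebesgue_integral_def)
  have "integral\<^sup>L lborel (?h N) \<le> infsum u UNIV" for N
  proof -
    have "integral\<^sup>L lborel (?h N) = (\<Sum>n\<in>{- int N..<int N}. integral {0..1} (\<lambda>x. cmod (g (x + of_int n))))"
      unfolding eq by (rule integral_eq_sum_unit_intervals[OF cn])
    also have "\<dots> \<le> (\<Sum>n\<in>{- int N..<int N}. u n)"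
    proof (rule sum_mono)
      fix n
      have "integral {0..1} (\<lambda>x. cmod (g (x + of_int n))) \<le> integral {0..1} (\<lambda>x::real. u n)"
        by (intro integral_le integrable_continuous_real continuous_on_compose2[OF cn] continuous_intros bnd) auto
      then show "integral {0..1} (\<lambda>x. cmod (g (x + of_int n))) \<le> u n" by simp
    qed
    also have "\<dots> \<le> infsum u UNIV"
      by (intro finite_sum_le_infsum u) (auto simp: u0)
    finally show ?thesis .
  qed
  moreover have "incseq (\<lambda>N. integral\<^sup>L lborel (?h N))"
    by (intro incseq_SucI integral_mono int) (auto simp: indicator_def)
  ultimately obtain l where l: "(\<lambda>N. integral\<^sup>L lborel (?h N)) \<longlonglongrightarrow> l"
    using incseq_convergent by blast
  have "integrable lborel (\<lambda>x. cmod (g x))"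
  proof (rule integrable_monotone_convergence[where f = ?h])
    show "AE x in lborel. (\<lambda>N. ?h N x) \<longlonglongrightarrow> cmod (g x)"
    proof (rule AE_I2)
      fix x :: real
      have "\<forall>\<^sub>F N in sequentially. \<bar>x\<bar> \<le> real N"
        by (rule eventually_real_ge)
      then have "\<forall>\<^sub>F N in sequentially. ?h N x = cmod (g x)"
        by eventually_elim (auto simp: indicator_def)
      then show "(\<lambda>N. ?h N x) \<longlonglongrightarrow> cmod (g x)"
        by (rule tendsto_eventually)
    qed
  qed (use int l in \<open>auto simp: mono_def indicator_def\<close>)
  then show ?thesis by (subst (asm) integrable_norm_iff) auto
qed

text \<open>This turns convergence of unordered sums over the integers into convergence of the
  symmetric partial sums, which match the integrals over [-N, N].\<close>

lemma filterlim_symmetric_int_intervals: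
  "filterlim (\<lambda>N. {- int N..<int N}) (finite_subsets_at_top UNIV) sequentially"
  unfolding filterlim_finite_subsets_at_top
proof (intro allI impI)
  fix X :: "int set" assume "finite X \<and> X \<subseteq> UNIV"
  then have "finite ((\<lambda>n. nat \<bar>n\<bar>) ` X)" by simp
  then obtain K where "\<And>n. n \<in> X \<Longrightarrow> nat \<bar>n\<bar> < K"
    by (metis finite_nat_set_iff_bounded imageI)
  then have "X \<subseteq> {- int N..<int N}" if "N \<ge> K" for N
    using that by fastforce
  then show "\<forall>\<^sub>F N in sequentially. finite {- int N..<int N} \<and> X \<subseteq> {- int N..<int N} \<and> {- int N..<int N} \<subseteq> UNIV"
    by (auto simp: eventually_sequentially)
qed

lemma cis_2pi_int_mult: "cis (2 * pi * of_int k * of_int n) = 1"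
  using cis_multiple_2pi[of "of_int (k * n)"] by (simp add: mult.assoc)

text \<open>The two sides are the values at 0 of the periodization \<open>H\<close> and of the
  series \<open>G\<close>. The two summability hypotheses make both converge uniformly on [0, 1], so
  coefficients can be computed from partial sums.\<close>

lemma poisson_summation:
  fixes g :: "real \<Rightarrow> complex"
  assumes g: "continuous_on UNIV g"
    and u: "u summable_on (UNIV :: int set)"
    and bnd: "\<And>x n. x \<in> {0..1} \<Longrightarrow> cmod (g (x + of_int n)) \<le> u n"
    and ghat: "(\<lambda>k. cmod (fourier g (of_int k))) summable_on (UNIV :: int set)"
  shows "infsum (\<lambda>n. g (of_int n)) (UNIV :: int set) = infsum (\<lambda>k. fourier g (of_int k)) (UNIV :: int set)"
proof -
  define H where "H x = infsum (\<lambda>n. g (x + of_int n)) (UNIV :: int set)" for x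
  define G where "G x = infsum (\<lambda>k. fourier g (of_int k) * cis (2 * pi * of_int k * x)) (UNIV :: int set)" for x
  have gs: "continuous_on S (\<lambda>x. g (x + c))" for S c
    by (intro continuous_on_compose2[OF g] continuous_intros) auto
  have ulH: "uniform_limit {0..1} (\<lambda>N x. \<Sum>n\<in>{- int N..<int N}. g (x + of_int n)) H sequentially"
    unfolding H_def
    by (rule filterlim_compose[OF Weierstrass_m_test_general filterlim_symmetric_int_intervals])
       (use u bnd in auto)
  have ulG: "uniform_limit {0..1} (\<lambda>N x. \<Sum>k\<in>{- int N..<int N}. fourier g (of_int k) * cis (2 * pi * of_int k * x)) G sequentially"
    unfolding G_def
    by (rule filterlim_compose[OF Weierstrass_m_test_general filterlim_symmetric_int_intervals])
       (use ghat in \<open>auto simp: norm_mult\<close>)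
  have cH: "continuous_on {0..1} H"
    by (rule uniform_limit_theorem[OF _ ulH]) (auto intro!: always_eventually continuous_intros gs)
  have cG: "continuous_on {0..1} G"
    by (rule uniform_limit_theorem[OF _ ulG]) (auto intro!: always_eventually continuous_intros)
  have cis_bd: "bounded ((\<lambda>x. cis (2 * pi * of_int k * x)) ` {0..1})" for k
    by (auto simp: bounded_iff intro!: exI[of _ 1])
  have bd: "bounded (F ` {0..1})" if "continuous_on {0..1} F" for F :: "real \<Rightarrow> complex"
    using that compact_continuous_image compact_imp_bounded by blast
  \<comment> \<open>Uniform convergence survives multiplication by a bounded character and passes to
    integrals over [0, 1].\<close>
  have lim: "(\<lambda>N. integral {0..1} (\<lambda>x. S N x * cis (2 * pi * of_int k * x))) \<longlonglongrightarrow> fcoeff F k"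
    if S: "uniform_limit {0..1} S F sequentially" "\<And>N. continuous_on {0..1} (S N)" and F: "continuous_on {0..1} F" for S F k
  proof -
    have ul: "uniform_limit {0..1} (\<lambda>N x. S N x * cis (2 * pi * of_int k * x)) (\<lambda>x. F x * cis (2 * pi * of_int k * x)) sequentially"
      by (intro uniform_lim_mult S uniform_limit_const cis_bd bd F)
    obtain I J where "\<And>N. ((\<lambda>x. S N x * cis (2 * pi * of_int k * x)) has_integral I N) {0..1}"
       "((\<lambda>x. F x * cis (2 * pi * of_int k * x)) has_integral J) {0..1}" "I \<longlonglongrightarrow> J"
      by (rule uniform_limit_integral[OF ul]) (auto intro!: continuous_intros S)
    then show ?thesis
      unfolding fcoeff_def by (metis (no_types, lifting) ext integral_unique)
  qed
  have fH: "fcoeff H k = fourier g (of_int (- k))" for k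
  proof -
    let ?h = "\<lambda>x. g x * cis (2 * pi * of_int k * x)"
    have ch: "continuous_on UNIV ?h"
      by (intro continuous_intros g)
    have ih: "integrable lborel ?h"
      by (rule integrable_periodic_bound[OF ch u]) (use bnd in \<open>auto simp: norm_mult\<close>)
    have eq: "integral {- real N..real N} ?h
        = integral {0..1} (\<lambda>x. (\<Sum>n\<in>{- int N..<int N}. g (x + of_int n)) * cis (2 * pi * of_int k * x))" for N
    proof -
      \<comment> \<open>The character has period 1, so the integral over [-N, N] folds into a
        coefficient of the partial sum of the periodization.\<close>
      have "cis (2 * pi * of_int k * (x + of_int n)) = cis (2 * pi * of_int k * x)" for x :: real and n :: int
        unfolding distrib_left cis_mult[symmetric] cis_2pi_int_mult by simp
      then have "integral {- real N..real N} ?h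
          = (\<Sum>n\<in>{- int N..<int N}. integral {0..1} (\<lambda>x. g (x + of_int n) * cis (2 * pi * of_int k * x)))"
        by (subst integral_eq_sum_unit_intervals[OF ch]) simp
      also have "\<dots> = integral {0..1} (\<lambda>x. (\<Sum>n\<in>{- int N..<int N}. g (x + of_int n)) * cis (2 * pi * of_int k * x))"
        unfolding sum_distrib_right
        by (rule integral_sum[symmetric]) (simp, intro integrable_continuous_real continuous_intros gs)
      finally show ?thesis .
    qed
    have "(\<lambda>N. integral {0..1} (\<lambda>x. (\<Sum>n\<in>{- int N..<int N}. g (x + of_int n)) * cis (2 * pi * of_int k * x)))
       \<longlonglongrightarrow> fcoeff H k"
      by (rule lim[OF ulH _ cH]) (intro continuous_intros gs)
    then have 1: "(\<lambda>N. integral {- real N..real N} ?h) \<longlonglongrightarrow> fcoeff H k"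
      by (simp only: eq)
    \<comment> \<open>A second evaluation of the same limit, now as the integral over the whole
      line. The plus sign in \<open>fcoeff\<close> makes it the transform at
      \<open>- k\<close>.\<close>
    have "(\<lambda>N. integral\<^sup>L lborel (\<lambda>x. indicator {- real N..real N} x *\<^sub>R ?h x)) \<longlonglongrightarrow> integral\<^sup>L lborel ?h"
    proof (rule integral_dominated_convergence[where w = "\<lambda>x. cmod (?h x)"])
      show "AE x in lborel. (\<lambda>N. indicator {- real N..real N} x *\<^sub>R ?h x) \<longlonglongrightarrow> ?h x"
      proof (rule AE_I2)
        fix x :: real
        have "\<forall>\<^sub>F N in sequentially. \<bar>x\<bar> \<le> real N"
          by (rule eventually_real_ge)
        then have "\<forall>\<^sub>F N in sequentially. indicator {- real N..real N} x *\<^sub>R ?h x = ?h x"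
          by eventually_elim (auto simp: indicator_def)
        then show "(\<lambda>N. indicator {- real N..real N} x *\<^sub>R ?h x) \<longlonglongrightarrow> ?h x"
          by (rule tendsto_eventually)
      qed
    qed (use ih in \<open>auto simp: indicator_def\<close>)
    moreover have "integral\<^sup>L lborel (\<lambda>x. indicator {- real N..real N} x *\<^sub>R ?h x) = integral {- real N..real N} ?h" for N
      using set_borel_integral_eq_integral(2)[of "{- real N..real N}" ?h]
        borel_integrable_compact[OF compact_Icc continuous_on_subset[OF ch], of "- real N" "real N"]
      by (simp add: set_integrable_def set_lebesgue_integral_def)
    ultimately have "(\<lambda>N. integral {- real N..real N} ?h) \<longlonglongrightarrow> integral\<^sup>L lborel ?h"
      by simp
    with 1 have "fcoeff H k = integral\<^sup>L lborel ?h"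
      using LIMSEQ_unique by blast
    also have "\<dots> = fourier g (of_int (- k))"
      unfolding fourier_def by (simp add: cis_conv_exp mult_ac)
    finally show ?thesis .
  qed
  have fG: "fcoeff G k = fourier g (of_int (- k))" for k
  proof -
    have one: "integral {0..1} (\<lambda>x. cis (2 * pi * of_int j * x)) = (if j = 0 then 1 else 0)" for j :: int
    proof (cases "j = 0")
      case False
      let ?F = "\<lambda>x::real. exp (of_real x * (2 * pi * of_int j * \<i>)) / (2 * pi * of_int j * \<i>)"
      have "((\<lambda>x. exp (of_real x * (2 * pi * of_int j * \<i>))) has_integral ?F 1 - ?F 0) {0..1}"
        by (rule fundamental_theorem_of_calculus, simp, rule has_vector_derivative_real_field)
           (use False in \<open>auto intro!: derivative_eq_intros\<close>)
      moreover have "?F 1 = ?F 0"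
        using cis_multiple_2pi[of "of_int j"] by (simp add: cis_conv_exp mult_ac)
      ultimately have "integral {0..1} (\<lambda>x::real. exp (of_real x * (2 * pi * of_int j * \<i>))) = 0"
        by (simp add: integral_unique)
      then show ?thesis using False by (simp add: cis_conv_exp mult_ac)
    qed simp
    \<comment> \<open>By orthogonality only the index j = -k survives.\<close>
    have "integral {0..1} (\<lambda>x. (\<Sum>j\<in>{- int N..<int N}. fourier g (of_int j) * cis (2 * pi * of_int j * x)) * cis (2 * pi * of_int k * x))
       = (if - k \<in> {- int N..<int N} then fourier g (of_int (- k)) else 0)" (is "?l N = ?r N") for N
    proof -
      have "?l N = integral {0..1} (\<lambda>x. (\<Sum>j\<in>{- int N..<int N}. fourier g (of_int j) * cis (2 * pi * of_int (j + k) * x)))"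
        unfolding sum_distrib_right by (simp add: mult.assoc cis_mult distrib_left distrib_right)
      also have "\<dots> = (\<Sum>j\<in>{- int N..<int N}. integral {0..1} (\<lambda>x. fourier g (of_int j) * cis (2 * pi * of_int (j + k) * x)))"
        by (rule integral_sum) (simp, intro integrable_continuous_real continuous_intros)
      also have "\<dots> = (\<Sum>j\<in>{- int N..<int N}. fourier g (of_int j) * (if j + k = 0 then 1 else 0))"
        by (simp only: integral_mult_right one)
      also have "\<dots> = (\<Sum>j\<in>{- int N..<int N}. if j = - k then fourier g (of_int j) else 0)"
        by (intro sum.cong) auto
      finally show ?thesis by simp
    qed
    moreover have "?l \<longlonglongrightarrow> fcoeff G k"
      by (rule lim[OF ulG _ cG]) (intro continuous_intros)
    ultimately have "?r \<longlonglongrightarrow> fcoeff G k" by simp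
    moreover have "?r \<longlonglongrightarrow> fourier g (of_int (- k))"
    proof (rule tendsto_eventually)
      show "\<forall>\<^sub>F N in sequentially. ?r N = fourier g (of_int (- k))"
        \<comment> \<open>The extra 1 is there because the range omits its upper end, which -k would
          hit for negative k and N = |k|.\<close>
        unfolding eventually_sequentially by (rule exI[of _ "nat \<bar>k\<bar> + 1"]) auto
    qed
    ultimately show ?thesis using LIMSEQ_unique by blast
  qed
  have "H 1 = H 0"
  proof -
    have "H 1 = infsum (\<lambda>n. g (of_int (n + 1))) (UNIV :: int set)"
      by (simp add: H_def add.commute)
    also have "\<dots> = infsum (\<lambda>n. g (of_int n)) (UNIV :: int set)"
      by (rule infsum_reindex_bij_betw[where g = "\<lambda>n. n + 1"])
         (rule bij_betwI[of _ _ _ "\<lambda>n. n - 1"], auto)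
    finally show ?thesis by (simp add: H_def)
  qed
  moreover have "G 1 = G 0"
    using cis_2pi_int_mult[of _ 1] by (simp add: G_def)
  ultimately have "H 0 - G 0 = 0"
  proof (intro fcoeff_unique[where D = "\<lambda>x. H x - G x" and t = 0])
    show "fcoeff (\<lambda>x. H x - G x) k = 0" for k
    proof -
      have "fcoeff (\<lambda>x. H x - G x) k = fcoeff H k - fcoeff G k"
        unfolding fcoeff_def left_diff_distrib
        by (intro integral_diff integrable_continuous_real continuous_intros cH cG)
      then show ?thesis by (simp add: fH fG)
    qed
  qed (auto intro!: continuous_intros cH cG)
  then show ?thesis by (simp add: H_def G_def)
qed

subsection \<open>Lattice sums\<close>

text \<open>Split zeta(b) by the parity of the denominator: the even ones give 2^(-b) zeta(b), the
  odd ones give 2^(-b) times the sum of (n + 1/2)^(-b) over n >= 0. So the latter sum is (2^b - 1)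
  zeta(b), and the two signs of k double it.\<close>

lemma has_sum_half_integers:
  assumes "b > 1"
  shows "((\<lambda>k. (\<bar>of_int k\<bar> - 1 / 2) powr (- b)) has_sum 2 * (2 powr b - 1) * zeta b) (- {0 :: int})"
    (is "(?w has_sum _) _")
proof -
  define f where "f n = 1 / real (Suc n) powr b" for n
  have "summable (\<lambda>n. real (Suc n) powr (- b))"
    using summable_real_powr_iff[of "- b"] assms by (subst summable_Suc_iff) auto
  then have "f sums zeta b"
    unfolding zeta_def f_def[abs_def] by (simp add: powr_minus_divide summable_sums)
  \<comment> \<open>The index is offset by one: \<open>f (2 * n + 1)\<close> has the even
    denominator 2n + 2, and \<open>f (2 * n)\<close> the odd one 2n + 1.\<close>
  moreover have "f (2 * n + 1) = 2 powr (- b) * f n" for n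
  proof -
    have "real (Suc (2 * n + 1)) powr b = (2 * real (Suc n)) powr b"
      by (simp add: algebra_simps)
    also have "\<dots> = 2 powr b * real (Suc n) powr b"
      by (simp only: powr_mult)
    finally show ?thesis by (simp add: f_def powr_minus_divide)
  qed
  moreover have "f (2 * n) = 2 powr (- b) * (real n + 1 / 2) powr (- b)" for n
  proof -
    have "real (Suc (2 * n)) powr b = (2 * (real n + 1 / 2)) powr b"
      by (simp add: algebra_simps)
    also have "\<dots> = 2 powr b * (real n + 1 / 2) powr b"
      by (simp only: powr_mult)
    finally show ?thesis by (simp add: f_def powr_minus_divide)
  qed
  ultimately have "(\<lambda>n. 2 powr (- b) * (real n + 1 / 2) powr (- b) + 2 powr (- b) * f n) sums zeta b"
    and f: "f sums zeta b"
    using sums_group[of f "zeta b" 2] by (simp_all add: mult.commute numeral_2_eq_2)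
  from sums_diff[OF this(1) sums_mult[OF f, of "2 powr (- b)"]]
  have "(\<lambda>n. 2 powr (- b) * (real n + 1 / 2) powr (- b)) sums (zeta b - 2 powr (- b) * zeta b)"
    by simp
  from sums_mult[OF this, of "2 powr b"]
  have "(\<lambda>n. (real n + 1 / 2) powr (- b)) sums ((2 powr b - 1) * zeta b)"
    by (simp add: mult.assoc[symmetric] right_diff_distrib left_diff_distrib powr_add[symmetric])
  then have h: "((\<lambda>n. (real n + 1 / 2) powr (- b)) has_sum (2 powr b - 1) * zeta b) UNIV"
    by (rule sums_nonneg_imp_has_sum) simp
  have "(?w has_sum (2 powr b - 1) * zeta b) {0<..} \<longleftrightarrow>
      ((\<lambda>n. (real n + 1 / 2) powr (- b)) has_sum (2 powr b - 1) * zeta b) UNIV"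
    by (rule has_sum_reindex_bij_witness[of _ "\<lambda>n. int n + 1" "\<lambda>k. nat (k - 1)"]) auto
  then have pos: "(?w has_sum (2 powr b - 1) * zeta b) {0<..}"
    using h by simp
  then have "(?w has_sum (2 powr b - 1) * zeta b) {..<0}"
    by (subst has_sum_reindex_bij_witness[of "{..<0}" uminus uminus "{0<..}" ?w]) auto
  with pos have "(?w has_sum (2 powr b - 1) * zeta b + (2 powr b - 1) * zeta b) ({0<..} \<union> {..<0})"
    by (intro has_sum_Un_disjoint) auto
  moreover have "{0<..} \<union> {..<0} = - {0 :: int}" by auto
  ultimately show ?thesis by (simp only: mult_2 distrib_right)
qed

text \<open>Away from 0 the terms are dominated by the half-integer powers, since 1 + |n| exceeds
  |n| - 1/2; a single further index does not affect summability.\<close>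

lemma summable_on_int_powr:
  assumes "a > 1"
  shows "(\<lambda>n. (1 + \<bar>of_int n\<bar>) powr (- a) :: real) summable_on (UNIV :: int set)"
proof -
  have "(\<lambda>n. (1 + \<bar>of_int n\<bar>) powr (- a) :: real) summable_on (- {0 :: int})"
  proof (rule summable_on_comparison_test)
    show "(\<lambda>k. (\<bar>of_int k\<bar> - 1 / 2) powr (- a)) summable_on (- {0 :: int})"
      using has_sum_half_integers[OF assms] by (rule has_sum_imp_summable)
    show "(1 + \<bar>real_of_int n\<bar>) powr (- a) \<le> (\<bar>real_of_int n\<bar> - 1 / 2) powr (- a)"
      if "n \<in> - {0}" for n
      using that assms by (intro powr_mono2') auto
  qed simp
  then have "(\<lambda>n. (1 + \<bar>of_int n\<bar>) powr (- a) :: real) summable_on insert 0 (- {0 :: int})"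
    by (simp only: summable_on_insert_iff)
  then show ?thesis by (simp add: Compl_eq_Diff_UNIV insert_Diff)
qed

lemma norm_infsum_le_has_sum:
  fixes f :: "'a \<Rightarrow> 'b::banach"
  assumes "(u has_sum S) A" "\<And>x. x \<in> A \<Longrightarrow> norm (f x) \<le> u x"
  shows "norm (infsum f A) \<le> S"
proof -
  have s: "(\<lambda>x. norm (f x)) summable_on A"
    by (rule Infinite_Sum.abs_summable_on_comparison_test'[OF has_sum_imp_summable]) (use assms in auto)
  have "norm (infsum f A) \<le> infsum (\<lambda>x. norm (f x)) A"
    by (rule norm_infsum_bound[OF s])
  also have "\<dots> \<le> S"
    by (rule has_sum_mono[OF has_sum_infsum[OF s]]) (use assms in auto)
  finally show ?thesis .
qed

section \<open>Tiling the integers by translates of the centered index set\<close>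

lemma centered_double: "centered (2 * m) = {- int m<..int m}"
  unfolding centered_def by auto

text \<open>This is division with remainder by 2m, with remainders taken in the centered window; an
  integer lies outside the window exactly when its quotient is nonzero.\<close>

lemma bij_betw_centered_translates:
  assumes "m > 0"
  shows "bij_betw (\<lambda>(j, k). j + k * int (2 * m)) (centered (2 * m) \<times> - {0}) (- centered (2 * m))"
proof -
  \<comment> \<open>Adding m - 1 carries the window -m < j <= m onto 0, ..., 2m - 1, the remainders
    of \<open>div\<close>.\<close>
  define q where "q n = (n + int m - 1) div (2 * int m)" for n
  have q: "j + k * (2 * int m) \<in> centered (2 * m) \<longleftrightarrow> k = 0" "q (j + k * (2 * int m)) = k"
    if "j \<in> centered (2 * m)" for j k
  proof -
    have "q (j + k * (2 * int m)) = (j + int m - 1 + k * (2 * int m)) div (2 * int m)"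
      by (simp add: q_def algebra_simps)
    also have "\<dots> = k + (j + int m - 1) div (2 * int m)"
      using assms by simp
    also have "(j + int m - 1) div (2 * int m) = 0"
      using that by (intro div_pos_pos_trivial) (auto simp: centered_double)
    finally show *: "q (j + k * (2 * int m)) = k" by simp
    have "q n = 0" if "n \<in> centered (2 * m)" for n
      unfolding q_def using that by (intro div_pos_pos_trivial) (auto simp: centered_double)
    then show "j + k * (2 * int m) \<in> centered (2 * m) \<longleftrightarrow> k = 0"
      using * that by force
  qed
  have r: "n - q n * (2 * int m) \<in> centered (2 * m)" for n
  proof -
    have "n + int m - 1 - q n * (2 * int m) = (n + int m - 1) mod (2 * int m)"
      unfolding q_def by (simp add: minus_div_mult_eq_mod)
    moreover have "0 \<le> (n + int m - 1) mod (2 * int m)" "(n + int m - 1) mod (2 * int m) < 2 * int m"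
      using assms by simp_all
    ultimately show ?thesis by (auto simp: centered_double)
  qed
  show ?thesis
  proof (rule bij_betwI[of _ _ _ "\<lambda>n. (n - q n * (2 * int m), q n)"])
    show "(\<lambda>n. (n - q n * (2 * int m), q n)) \<in> - centered (2 * m) \<rightarrow> centered (2 * m) \<times> - {0}"
    proof (intro funcsetI)
      fix n assume n: "n \<in> - centered (2 * m)"
      have "q n \<noteq> 0" using r[of n] n by auto
      then show "(n - q n * (2 * int m), q n) \<in> centered (2 * m) \<times> - {0}" using r by auto
    qed
  qed (use q in \<open>auto simp: mult.commute\<close>)
qed

text \<open>Used to sum a bound that depends only on the translate \<open>k\<close>: the 2m points
  of the window contribute equally.\<close>

lemma has_sum_centered_times:
  assumes "(h has_sum S) B" "\<And>k. k \<in> B \<Longrightarrow> 0 \<le> (h k :: real)"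
  shows "((\<lambda>(j, k). h k) has_sum real (2 * m) * S) (centered (2 * m) \<times> B)"
proof -
  have "((\<lambda>j. S) has_sum real (2 * m) * S) (centered (2 * m))"
    using has_sum_constant[of "centered (2 * m)" S] by (simp add: centered_double)
  moreover have "(\<lambda>(j, k). h k) summable_on (centered (2 * m) \<times> B)"
    by (rule summable_on_SigmaI[where g = "\<lambda>_. S"]) (use assms in \<open>auto simp: centered_double\<close>)
  ultimately show ?thesis
    by (intro has_sum_SigmaI[where g = "\<lambda>_. S"]) (use assms in auto)
qed

subsection \<open>The error estimate\<close>

text \<open>The supremum is taken in the extended reals, so its bound is a genuine bound at every
  point; the point 0 shows that \<open>c\<close> is nonnegative.\<close>

lemma decay_bound:
  assumes "(SUP x. ereal (cmod (f x) * (1 + \<bar>x\<bar>) powr a)) \<le> ereal c"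
  shows "cmod (f x) \<le> c * (1 + \<bar>x\<bar>) powr (- a)" "0 \<le> c"
proof -
  have "ereal (cmod (f x) * (1 + \<bar>x\<bar>) powr a) \<le> ereal c" for x
    using assms by (simp add: SUP_le_iff)
  then have *: "cmod (f x) * (1 + \<bar>x\<bar>) powr a \<le> c" for x
    by simp
  have "(1 + \<bar>x\<bar>) powr a > 0" by simp
  then show "cmod (f x) \<le> c * (1 + \<bar>x\<bar>) powr (- a)"
    using *[of x] by (simp add: powr_minus field_simps)
  show "0 \<le> c"
    using *[of 0] norm_ge_zero[of "f 0"] by (simp del: norm_ge_zero)
qed

text \<open>Separates the scale \<open>q\<close>, which will be P or L, from the factor
  \<open>y\<close> = |k| - 1/2 that is summed over the lattice.\<close>

lemma decay_bound_scaled: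
  assumes "\<And>x. cmod (f x) \<le> c * (1 + \<bar>x\<bar>) powr (- a)" "0 \<le> c" "0 < a"
    and "q > 0" "y > 0" "\<bar>x\<bar> \<ge> y * q"
  shows "cmod (f x) \<le> c * q powr (- a) * y powr (- a)"
proof -
  have "0 < y * q" using assms by simp
  then have "(1 + \<bar>x\<bar>) powr (- a) \<le> (y * q) powr (- a)"
    using assms by (intro powr_mono2') auto
  then have "c * (1 + \<bar>x\<bar>) powr (- a) \<le> c * (y * q) powr (- a)"
    using assms(2) by (rule mult_left_mono)
  also have "(y * q) powr (- a) = y powr (- a) * q powr (- a)"
    by (rule powr_mult)
  finally show ?thesis
    using assms(1)[of x] by (simp add: mult_ac)
qed

text \<open>The substitution x = p y produces the factor \<open>p\<close> and dilates the frequency,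
  while the modulation translates it by \<open>v\<close>.\<close>

lemma fourier_rescaled_modulated:
  assumes "p > 0"
  shows "fourier (\<lambda>x. f (x / p) * cis (- (2 * pi * v / p) * x)) w = of_real p * fourier f (v + w * p)"
proof -
  define F where "F y = f y * exp (- (2 * of_real pi * \<i> * of_real y * of_real (v + w * p)))" for y
  have "f (x / p) * cis (- (2 * pi * v / p) * x) * exp (- (2 * of_real pi * \<i> * of_real x * of_real w))
      = F (0 + 1 / p * x)" for x
  proof -
    have "\<i> * of_real (- (2 * pi * v / p) * x) + - (2 * of_real pi * \<i> * of_real x * of_real w)
        = - (2 * of_real pi * \<i> * of_real (x / p) * of_real (v + w * p))"
      using assms by (simp add: field_simps)
    then show ?thesis
      by (simp only: F_def cis_conv_exp mult.assoc exp_add[symmetric]) simp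
  qed
  moreover have "integral\<^sup>L lborel F = \<bar>1 / p\<bar> *\<^sub>R (LINT x|lborel. F (0 + 1 / p * x))"
    by (rule lborel_integral_real_affine) (use assms in auto)
  moreover have "fourier f (v + w * p) = integral\<^sup>L lborel F"
    unfolding fourier_def F_def ..
  ultimately show ?thesis
    using assms by (simp add: fourier_def scaleR_conv_of_real)
qed

text \<open>Poisson summation for \<open>g\<close> reads P s + T = P (fourier f v + R), with T the
  sum of the samples outside the window and R the aliased frequencies. The error is therefore T/P -
  R, and the two parts use the decay of f and of its transform separately.\<close>

lemma fourier_minus_s_sum_bound:
  fixes L P :: nat
  assumes L: "even L" "L > 0" and P: "P > 0"
    and f: "continuous_on UNIV f"
    and a: "a > 1" and fa: "\<And>x. cmod (f x) \<le> c * (1 + \<bar>x\<bar>) powr (- a)" and c: "0 \<le> c"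
    and b: "b > 1" and fb: "\<And>v. cmod (fourier f v) \<le> d * (1 + \<bar>v\<bar>) powr (- b)" and d: "0 \<le> d"
    and v: "\<bar>v\<bar> \<le> real P / 2"
  shows "cmod (fourier f v - s_sum P L f v)
       \<le> 2 * d * (2 powr b - 1) * zeta b * real P powr (- b)
         + 2 * c * (2 powr a - 1) * zeta a * (real L * real L powr (- a))"
proof -
  define g where "g x = f (x / real P) * cis (- (2 * pi * v / real P) * x)" for x
  define m where "m = L div 2 * P"
  have m: "L * P = 2 * m" "m > 0" using L P by (auto simp: m_def)
  have P0: "real P > 0" using P by simp
  have cg: "continuous_on UNIV g"
    unfolding g_def using P
    by (intro continuous_intros continuous_on_compose2[OF f]) auto
  \<comment> \<open>The factor 1/(2P) comes from 1 + |n| <= 2 (1 + |x + n|) for x in [0, 1],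
    combined with P >= 1.\<close>
  define u where "u n = c * (1 / (2 * real P)) powr (- a) * (1 + \<bar>real_of_int n\<bar>) powr (- a)" for n :: int
  have u: "u summable_on UNIV"
    unfolding u_def by (intro summable_on_cmult_right summable_on_int_powr a)
  have gu: "cmod (g (x + of_int n)) \<le> u n" if "x \<in> {0..1}" for x n
  proof -
    have "(1 + \<bar>real_of_int n\<bar>) / (2 * real P) \<le> 1 + \<bar>(x + of_int n) / real P\<bar>"
    proof -
      have "1 + \<bar>real_of_int n\<bar> \<le> 2 * (1 + \<bar>x + of_int n\<bar>)"
        using that by (simp add: abs_if split: if_splits)
      also have "\<dots> \<le> 2 * (real P + \<bar>x + of_int n\<bar>)"
        using P by simp
      finally have "(1 + \<bar>real_of_int n\<bar>) / (2 * real P) \<le> 2 * (real P + \<bar>x + real_of_int n\<bar>) / (2 * real P)"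
        by (rule divide_right_mono) simp
      also have "\<dots> = 1 + \<bar>(x + of_int n) / real P\<bar>"
        using P by (simp add: field_simps abs_divide)
      finally show ?thesis .
    qed
    then have "(1 + \<bar>(x + of_int n) / real P\<bar>) powr (- a) \<le> ((1 + \<bar>real_of_int n\<bar>) / (2 * real P)) powr (- a)"
      using a P by (intro powr_mono2') auto
    also have "\<dots> = (1 / (2 * real P)) powr (- a) * (1 + \<bar>real_of_int n\<bar>) powr (- a)"
      by (subst powr_mult[symmetric]) simp
    finally have "c * (1 + \<bar>(x + of_int n) / real P\<bar>) powr (- a) \<le> u n"
      unfolding u_def mult.assoc using c by (rule mult_left_mono)
    then show ?thesis
      using fa[of "(x + of_int n) / real P"] by (simp add: g_def norm_mult)
  qed
  have ghat: "fourier g (of_int k) = of_nat P * fourier f (v + of_int k * real P)" for k :: int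
    unfolding g_def using fourier_rescaled_modulated[OF P0] by simp
  define w where "w s k = (\<bar>real_of_int k\<bar> - 1 / 2) powr (- s)" for s k
  have w: "(w a has_sum 2 * (2 powr a - 1) * zeta a) (- {0})" "(w b has_sum 2 * (2 powr b - 1) * zeta b) (- {0})"
    unfolding w_def by (intro has_sum_half_integers a b)+
  have pos: "\<bar>real_of_int k\<bar> - 1 / 2 > 0" if "k \<in> - {0}" for k
    using that by auto
  have fw: "cmod (fourier f (v + of_int k * real P)) \<le> d * real P powr (- b) * w b k" if k: "k \<in> - {0}" for k
    unfolding w_def
  proof (rule decay_bound_scaled[OF fb d _ P0 pos[OF k]])
    have "(\<bar>real_of_int k\<bar> - 1 / 2) * real P = \<bar>real_of_int k * real P\<bar> - real P / 2"
      by (simp add: abs_mult algebra_simps)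
    then show "(\<bar>real_of_int k\<bar> - 1 / 2) * real P \<le> \<bar>v + real_of_int k * real P\<bar>"
      using v by linarith
  qed (use b in simp)
  have fw_sum: "((\<lambda>k. d * real P powr (- b) * w b k) has_sum d * real P powr (- b) * (2 * (2 powr b - 1) * zeta b)) (- {0})"
    by (intro has_sum_cmult_right w)
  have U: "UNIV = insert 0 (- {0 :: int})" by auto
  have sf': "(\<lambda>k. cmod (fourier f (v + of_int k * real P))) summable_on (- {0 :: int})"
    by (rule Infinite_Sum.abs_summable_on_comparison_test'[OF has_sum_imp_summable[OF fw_sum] fw])
  then have "(\<lambda>k. cmod (fourier f (v + of_int k * real P))) summable_on (UNIV :: int set)"
    unfolding U by (simp only: summable_on_insert_iff)
  then have sg: "(\<lambda>k. cmod (fourier g (of_int k))) summable_on (UNIV :: int set)"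
    by (simp add: ghat norm_mult summable_on_cmult_right)
  have sf: "(\<lambda>k. fourier f (v + of_int k * real P)) summable_on (- {0 :: int})"
    using abs_summable_summable[OF sf'] .
  have poisson: "infsum (\<lambda>n. g (of_int n)) (UNIV :: int set) = infsum (\<lambda>k. fourier g (of_int k)) (UNIV :: int set)"
    by (rule poisson_summation[OF cg u gu sg])
  define T where "T = infsum (\<lambda>n. g (of_int n)) (- centered (2 * m))"
  define R where "R = infsum (\<lambda>k. fourier f (v + of_int k * real P)) (- {0 :: int})"
  have "infsum (\<lambda>k. fourier g (of_int k)) (UNIV :: int set) = of_nat P * (fourier f v + R)"
  proof -
    have "infsum (\<lambda>k. fourier g (of_int k)) (UNIV :: int set)
        = of_nat P * infsum (\<lambda>k. fourier f (v + of_int k * real P)) (insert 0 (- {0 :: int}))"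
      unfolding ghat U[symmetric] by (rule infsum_cmult_right')
    then show ?thesis
      by (subst (asm) infsum_insert) (use sf in \<open>auto simp: R_def\<close>)
  qed
  moreover have "infsum (\<lambda>n. g (of_int n)) (UNIV :: int set) = of_nat P * s_sum P L f v + T"
  proof -
    have "(\<lambda>n. cmod (g (of_int n))) summable_on (UNIV :: int set)"
      by (rule Infinite_Sum.abs_summable_on_comparison_test'[OF u]) (use gu[of 0] in simp)
    then have sg: "(\<lambda>n. g (of_int n)) summable_on (UNIV :: int set)"
      by (rule abs_summable_summable)
    have fin: "finite (centered (2 * m))"
      by (simp add: centered_double)
    have "infsum (\<lambda>n. g (of_int n)) (centered (2 * m) \<union> - centered (2 * m))
        = infsum (\<lambda>n. g (of_int n)) (centered (2 * m)) + T"
      unfolding T_def by (intro infsum_Un_disjoint summable_on_subset[OF sg]) auto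
    moreover have "infsum (\<lambda>n. g (of_int n)) (centered (2 * m)) = of_nat P * s_sum P L f v"
      using P fin by (simp add: s_sum_def m(1) g_def cis_conv_exp mult_ac)
    ultimately show ?thesis by simp
  qed
  ultimately have "of_nat P * (fourier f v - s_sum P L f v) = T - of_nat P * R"
    using poisson by (simp add: algebra_simps)
  then have "fourier f v - s_sum P L f v = T / of_nat P - R"
    using P by (simp add: field_simps)
  then have "cmod (fourier f v - s_sum P L f v) \<le> cmod T / real P + cmod R"
    using norm_triangle_ineq4[of "T / of_nat P" R] by (simp add: norm_divide)
  moreover have "cmod R \<le> d * real P powr (- b) * (2 * (2 powr b - 1) * zeta b)"
    unfolding R_def by (rule norm_infsum_le_has_sum[OF fw_sum fw])
  moreover have "cmod T \<le> c * real L powr (- a) * (real (2 * m) * (2 * (2 powr a - 1) * zeta a))"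
  proof -
    \<comment> \<open>The tail is regrouped into translates of the window, so that each term has a
      bound independent of its position \<open>j\<close> in the window.\<close>
    have "T = infsum (\<lambda>z. g (of_int (case z of (j, k) \<Rightarrow> j + k * int (2 * m)))) (centered (2 * m) \<times> - {0 :: int})"
      unfolding T_def by (rule infsum_reindex_bij_betw[OF bij_betw_centered_translates[OF m(2)], symmetric])
    also have "cmod \<dots> \<le> c * real L powr (- a) * (real (2 * m) * (2 * (2 powr a - 1) * zeta a))"
    proof (rule norm_infsum_le_has_sum[OF has_sum_cmult_right[OF has_sum_centered_times[OF w(1)]]])
      fix z :: "int \<times> int" assume "z \<in> centered (2 * m) \<times> - {0}"
      then obtain j k where z: "z = (j, k)" "j \<in> centered (2 * m)" "k \<in> - {0}" by auto
      let ?n = "j + k * int (2 * m)"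
      have "cmod (f (of_int ?n / real P)) \<le> c * real L powr (- a) * w a k"
        unfolding w_def
      proof (rule decay_bound_scaled[OF fa c])
        have "\<bar>real_of_int j\<bar> \<le> real m"
          using z(2) by (auto simp: centered_double)
        moreover have "\<bar>real_of_int k * real (2 * m)\<bar> = \<bar>real_of_int k\<bar> * (2 * real m)"
          by (simp add: abs_mult)
        ultimately have "(\<bar>real_of_int k\<bar> - 1 / 2) * (2 * real m) \<le> \<bar>real_of_int ?n\<bar>"
          by (simp add: left_diff_distrib)
        moreover have "2 * real m = real L * real P"
          using arg_cong[OF m(1), of real] by simp
        ultimately show "(\<bar>real_of_int k\<bar> - 1 / 2) * real L \<le> \<bar>real_of_int ?n / real P\<bar>"
          using P by (simp add: le_divide_eq mult.assoc)
      qed (use a L pos z in auto)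
      then show "cmod (g (of_int (case z of (j, k) \<Rightarrow> j + k * int (2 * m))))
          \<le> c * real L powr (- a) * (case z of (j, k) \<Rightarrow> w a k)"
        by (simp add: z g_def norm_mult)
    qed (simp add: w_def)
    finally show ?thesis .
  qed
  \<comment> \<open>The window has 2m = LP points; division by P leaves the factor L.\<close>
  then have "cmod T / real P \<le> c * real L powr (- a) * (real L * (2 * (2 powr a - 1) * zeta a))"
    unfolding m(1)[symmetric] using P by (simp add: divide_le_eq mult_ac)
  ultimately show ?thesis by (simp add: mult_ac)
qed

theorem theorem3p10:
  fixes L P :: nat and f :: "real \<Rightarrow> complex" and a b c d :: real
  assumes "even L" and "L > 0" and "even P" and "P > 0"
    and "continuous_on UNIV f" and "continuous_on UNIV (fourier f)"
    and "a > 1"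
    and "(SUP x. ereal (cmod (f x) * (1 + \<bar>x\<bar>) powr a)) \<le> ereal c"
    and "b > 1"
    and "(SUP v. ereal (cmod (fourier f v) * (1 + \<bar>v\<bar>) powr b)) \<le> ereal d"
  shows "Mstar P L f \<le> M P L f \<and>
         M P L f \<le> 2 * d * (2 powr b - 1) * zeta b * real L powr (- 1 / 2) * real P powr (- b)
                 + 2 * c * (2 powr a - 1) * zeta a * real L powr (- a + 1 / 2)"
proof -
  \<comment> \<open>At a maximizer \<open>v\<close> the pointwise estimate bounds \<open>M\<close>
    itself, and its value dominates all others in the band.\<close>
  obtain v where v: "\<bar>v\<bar> \<le> real P / 2"
      "M P L f = 1 / sqrt (real L) * cmod (fourier f v - s_sum P L f v)"
      "\<And>w. \<bar>w\<bar> \<le> real P / 2 \<Longrightarrow> cmod (fourier f w - s_sum P L f w) \<le> cmod (fourier f v - s_sum P L f v)"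
    using M_attained[OF assms(6), of P L] by blast
  have LP: "L * P = 2 * (L div 2 * P)" "L div 2 * P > 0"
    using assms by auto
  have "Mstar P L f \<le> M P L f"
    unfolding Mstar_def v(2)
  proof (intro mult_left_mono Max.boundedI)
    show "finite ((\<lambda>k. cmod (fourier f (real_of_int k / real L) - s_sum P L f (real_of_int k / real L))) ` centered (L * P))"
      unfolding LP(1) centered_double by simp
    \<comment> \<open>Nonemptiness makes \<open>MAX\<close> an actual maximum.\<close>
    have "0 \<in> centered (L * P)"
      unfolding LP(1) centered_double using LP(2) by simp
    then show "(\<lambda>k. cmod (fourier f (real_of_int k / real L) - s_sum P L f (real_of_int k / real L))) ` centered (L * P) \<noteq> {}"
      by blast
    fix y assume "y \<in> (\<lambda>k. cmod (fourier f (real_of_int k / real L) - s_sum P L f (real_of_int k / real L))) ` centered (L * P)"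
    then obtain k where k: "k \<in> centered (L * P)"
        "y = cmod (fourier f (real_of_int k / real L) - s_sum P L f (real_of_int k / real L))" by blast
    \<comment> \<open>Every sample frequency k/L lies in the band |v| <= P/2, so the discrete
      maximum runs over fewer points.\<close>
    have "\<bar>real_of_int k\<bar> \<le> real L * real P / 2"
      using k(1) by (auto simp: centered_def)
    then have "\<bar>real_of_int k / real L\<bar> \<le> real P / 2"
      using assms(2) by (simp add: field_simps)
    then show "y \<le> cmod (fourier f v - s_sum P L f v)"
      unfolding k(2) by (rule v(3))
  qed simp
  \<comment> \<open>Exponents add up as -1/2 + 1 - a, the 1 coming from the window size divided by P
    and the -1/2 from the normalization of \<open>M\<close>.\<close>
  have *: "real L powr (- 1 / 2) * (real L * real L powr (- a)) = real L powr (- a + 1 / 2)"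
  proof -
    have "real L powr (- 1 / 2) * (real L powr 1 * real L powr (- a)) = real L powr (- a + 1 / 2)"
      unfolding powr_add[symmetric] by simp
    then show ?thesis using assms(2) by simp
  qed
  have "M P L f \<le> 1 / sqrt (real L) * (2 * d * (2 powr b - 1) * zeta b * real P powr (- b)
         + 2 * c * (2 powr a - 1) * zeta a * (real L * real L powr (- a)))"
    unfolding v(2)
    by (intro mult_left_mono fourier_minus_s_sum_bound assms v(1)
         decay_bound[OF assms(8)] decay_bound[OF assms(10)]) simp
  moreover have "1 / sqrt (real L) = real L powr (- 1 / 2)"
    using assms(2) by (simp add: powr_minus_divide powr_half_sqrt)
  ultimately have "M P L f \<le> 2 * d * (2 powr b - 1) * zeta b * real L powr (- 1 / 2) * real P powr (- b)
       + 2 * c * (2 powr a - 1) * zeta a * (real L powr (- 1 / 2) * (real L * real L powr (- a)))"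
    by (simp add: distrib_left mult_ac)
  then show ?thesis
    unfolding * using \<open>Mstar P L f \<le> M P L f\<close> by blast
qed

end
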